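(* Let $\mathbb{K}$ be a field, $n\ge 2$, and let $I\subset \mathbb{K}[x_1,\ldots,x_n]$ be an Artinian monomial ideal. Let $0=d_0<d_1<\cdots<d_s$ be all the distinct degrees in $x_n$ of the elements of $\operatorname{Min}(I)$, and for $0\le k\le s$ let $I_k\subseteq \mathbb{K}[x_1,\ldots,x_{n-1}]$ be the monomial ideal generated by the monomials $\operatorname{Coeff}_{x_n}(m)$ with $m\in\operatorname{Min}(I)$ and $\deg_{x_n} m\le d_k$. Then $$\operatorname{Irr}(I)=\bigcup_{k=1}^{s}\big(\operatorname{Irr}(I_{k-1})\setminus \operatorname{Irr}(I_k)\big)\otimes d_k,$$ and this union is disjoint.
   Context: $\mathbb{N}=\{0,1,2,\ldots\}$. For $\alpha=(a_1,\ldots,a_n)\in\mathbb{N}^n$, $X^\alpha=x_1^{a_1}\cdots x_n^{a_n}$. A monomial ideal is an ideal generated by monomials; $\operatorname{Min}(I)$ denotes its unique minimal set of monomial generators. A monomial ideal is Artinian if it contains a power of each variable. For $\beta=(b_1,\ldots,b_n)$ with positive integer entries, $m^\beta=\langle x_1^{b_1},\ldots,x_n^{b_n}\rangle$. Every Artinian monomial ideal $I$ can be written uniquely as an irredundant intersection $I=\bigcap_{\beta} m^{\beta}$ of such ideals (irredundant: no component can be dropped), and $\operatorname{Irr}(I)$ denotes the finite set of exponent vectors $\beta$ occurring in it; for the unit ideal, $\operatorname{Irr}=\emptyset$. The same notation is used for monomial ideals in $\mathbb{K}[x_1,\ldots,x_{n-1}]$. For a monomial $m=x_1^{a_1}\cdots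 x_n^{a_n}$, $\operatorname{Coeff}_{x_n}(m)=x_1^{a_1}\cdots x_{n-1}^{a_{n-1}}$ and $\deg_{x_n} m=a_n$. For a set $U\subseteq\mathbb{N}^{n-1}$ and an integer $d$, $U\otimes d=\{(u,d):u\in U\}\subseteq \mathbb{N}^n$, where $(u,d)=(u_1,\ldots,u_{n-1},d)$. *)

theory Defs
  imports "HOL-Algebra.Ideal" "HOL-Library.Poly_Mapping" "HOL-Library.Disjoint_Sets"
begin

text \<open>
  Exponent vectors of \<open>\<nat>\<^sup>n\<close> are finitely supported functions \<open>nat \<Rightarrow>\<^sub>0 nat\<close> whose support lies in
  \<open>{1..n}\<close>; polynomials are elements of the monoid algebra \<open>(nat \<Rightarrow>\<^sub>0 nat) \<Rightarrow>\<^sub>0 'k\<close>. In this encoding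
  \<open>\<bbbK>[x\<^sub>1,\<dots>,x\<^sub>n\<^sub>-\<^sub>1]\<close> is literally a subset of \<open>\<bbbK>[x\<^sub>1,\<dots>,x\<^sub>n]\<close>.
\<close>

type_synonym expvec = "nat \<Rightarrow>\<^sub>0 nat"
type_synonym 'k mpol = "expvec \<Rightarrow>\<^sub>0 'k"

definition exps :: "nat \<Rightarrow> expvec set" where
  "exps n = {\<alpha>. Poly_Mapping.keys \<alpha> \<subseteq> {1..n}}"

definition pring :: "nat \<Rightarrow> ('k::field) mpol ring" where
  "pring n = \<lparr>carrier = {p. Poly_Mapping.keys p \<subseteq> exps n},
              mult = (*), one = 1, zero = 0, add = (+)\<rparr>"

lemma exps_zero: "0 \<in> exps n"
  by (simp add: exps_def)

lemma exps_add: "\<alpha> \<in> exps n \<Longrightarrow> \<beta> \<in> exps n \<Longrightarrow> \<alpha> + \<beta> \<in> exps n"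
  using Poly_Mapping.keys_add[of \<alpha> \<beta>] by (auto simp: exps_def)

lemma cring_pring: "cring (pring n :: ('k::field) mpol ring)"
proof (rule cringI)
  show "abelian_group (pring n :: 'k mpol ring)"
  proof (rule abelian_groupI)
    fix x :: "'k mpol" assume x: "x \<in> carrier (pring n)"
    have "- x \<in> carrier (pring n)" using x by (simp add: pring_def)
    then show "\<exists>y\<in>carrier (pring n). y \<oplus>\<^bsub>pring n\<^esub> x = \<zero>\<^bsub>pring n\<^esub>"
      by (intro bexI[of _ "- x"]) (auto simp: pring_def)
  next
    fix x y :: "'k mpol" assume "x \<in> carrier (pring n)" "y \<in> carrier (pring n)"
    then show "x \<oplus>\<^bsub>pring n\<^esub> y \<in> carrier (pring n)"
      using Poly_Mapping.keys_add[of x y] by (auto simp: pring_def)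
  qed (auto simp: pring_def algebra_simps)
  show "Group.comm_monoid (pring n :: 'k mpol ring)"
  proof (rule comm_monoidI)
    fix x y :: "'k mpol" assume "x \<in> carrier (pring n)" "y \<in> carrier (pring n)"
    then show "x \<otimes>\<^bsub>pring n\<^esub> y \<in> carrier (pring n)"
      using Poly_Mapping.keys_mult[of x y] by (auto simp: pring_def intro!: exps_add)
  qed (auto simp: pring_def exps_zero algebra_simps)
qed (auto simp: pring_def algebra_simps)

definition mon :: "expvec \<Rightarrow> ('k::field) mpol" where
  "mon \<alpha> = Poly_Mapping.single \<alpha> 1"

text \<open>The exponent vector of a monomial; meaningless on polynomials that are not monomials.\<close>

definition mon_exp :: "('k::field) mpol \<Rightarrow> expvec" where
  "mon_exp m = (THE \<alpha>. m = mon \<alpha>)"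

lemma mon_exp_mon: "mon_exp (mon \<alpha> :: ('k::field) mpol) = \<alpha>"
proof -
  have "\<beta> = \<alpha>" if "mon \<alpha> = (mon \<beta> :: 'k mpol)" for \<beta>
  proof -
    have "Poly_Mapping.keys (mon \<alpha> :: 'k mpol) = Poly_Mapping.keys (mon \<beta> :: 'k mpol)"
      using that by simp
    then show ?thesis by (simp add: mon_def)
  qed
  then show ?thesis unfolding mon_exp_def by (intro the_equality) auto
qed

definition mon_deg :: "nat \<Rightarrow> ('k::field) mpol \<Rightarrow> nat" where
  "mon_deg i m = Poly_Mapping.lookup (mon_exp m) i"

definition mon_coeff :: "nat \<Rightarrow> ('k::field) mpol \<Rightarrow> 'k mpol" where
  "mon_coeff i m = mon (Poly_Mapping.update i 0 (mon_exp m))"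

definition monomial_ideal :: "nat \<Rightarrow> ('k::field) mpol set \<Rightarrow> bool" where
  "monomial_ideal n I \<longleftrightarrow> (\<exists>G \<subseteq> mon ` exps n. I = Idl\<^bsub>pring n\<^esub> G)"

definition artinian_monomial_ideal :: "nat \<Rightarrow> ('k::field) mpol set \<Rightarrow> bool" where
  "artinian_monomial_ideal n I \<longleftrightarrow>
     monomial_ideal n I \<and> (\<forall>i\<in>{1..n}. \<exists>b. mon (Poly_Mapping.single i b) \<in> I)"

definition is_min_gens :: "nat \<Rightarrow> ('k::field) mpol set \<Rightarrow> 'k mpol set \<Rightarrow> bool" where
  "is_min_gens n I G \<longleftrightarrow>
     G \<subseteq> mon ` exps n \<and> Idl\<^bsub>pring n\<^esub> G = I \<and> (\<forall>H. H \<subset> G \<longrightarrow> Idl\<^bsub>pring n\<^esub> H \<noteq> I)"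

definition min_gens :: "nat \<Rightarrow> ('k::field) mpol set \<Rightarrow> 'k mpol set" where
  "min_gens n I = (THE G. is_min_gens n I G)"

definition pos_exps :: "nat \<Rightarrow> expvec set" where
  "pos_exps n = {\<beta> \<in> exps n. \<forall>i\<in>{1..n}. Poly_Mapping.lookup \<beta> i > 0}"

definition irr_comp :: "nat \<Rightarrow> expvec \<Rightarrow> ('k::field) mpol set" where
  "irr_comp n \<beta> =
     Idl\<^bsub>pring n\<^esub> ((\<lambda>i. mon (Poly_Mapping.single i (Poly_Mapping.lookup \<beta> i))) ` {1..n})"

text \<open>Intersecting with the carrier makes the empty intersection the unit ideal.\<close>

definition comp_inter :: "nat \<Rightarrow> expvec set \<Rightarrow> ('k::field) mpol set" where
  "comp_inter n B = carrier (pring n) \<inter> (\<Inter>\<beta>\<in>B. irr_comp n \<beta>)"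

definition is_irr_decomp :: "nat \<Rightarrow> ('k::field) mpol set \<Rightarrow> expvec set \<Rightarrow> bool" where
  "is_irr_decomp n I B \<longleftrightarrow>
     finite B \<and> B \<subseteq> pos_exps n \<and> comp_inter n B = I \<and>
     (\<forall>\<beta>\<in>B. comp_inter n (B - {\<beta>}) \<noteq> I)"

definition Irr :: "nat \<Rightarrow> ('k::field) mpol set \<Rightarrow> expvec set" where
  "Irr n I = (THE B. is_irr_decomp n I B)"

text \<open>The ideal of \<open>\<bbbK>[x\<^sub>1,\<dots>,x\<^sub>n\<^sub>-\<^sub>1]\<close> obtained from the minimal generators of degree at most \<open>e\<close> in \<open>x\<^sub>n\<close>.\<close>

definition coeff_ideal :: "nat \<Rightarrow> ('k::field) mpol set \<Rightarrow> nat \<Rightarrow> 'k mpol set" where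
  "coeff_ideal n I e =
     Idl\<^bsub>pring (n - 1)\<^esub> (mon_coeff n ` {m \<in> min_gens n I. mon_deg n m \<le> e})"

text \<open>\<open>U \<otimes> d\<close> for \<open>U \<subseteq> \<nat>\<^sup>n\<^sup>-\<^sup>1\<close>: the entry \<open>d\<close> is put in position \<open>n\<close>.\<close>

definition append_coord :: "nat \<Rightarrow> expvec set \<Rightarrow> nat \<Rightarrow> expvec set" where
  "append_coord n U d = Poly_Mapping.update n d ` U"

end

theory Submission
  imports Defs
begin

text \<open>
  A monomial ideal is the span of the monomials whose exponents lie in an up-set \<open>A\<close> of \<open>\<nat>\<^sup>n\<close>, and
  \<open>m\<^sup>\<beta>\<close> corresponds to the complement of the box \<open>{\<alpha>. \<alpha> \<le> \<beta> - (1,\<dots>,1)}\<close>. Hence, when the complement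
  of \<open>A\<close> is finite, the irreducible components are the corners of \<open>A\<close>: the positive \<open>\<beta>\<close> for which
  \<open>\<beta> - (1,\<dots>,1)\<close> is maximal outside \<open>A\<close>. Let \<open>A\<^sub>e = {u. (u,e) \<in> A}\<close>, which is an increasing family. A
  vector \<open>(u,c)\<close> is a corner of \<open>A\<close> iff \<open>u\<close> is a corner of \<open>A\<^bsub>c-1\<^esub>\<close> and \<open>u - (1,\<dots>,1) \<in> A\<^sub>c\<close>; the second
  condition says that \<open>u\<close> is not also a corner of \<open>A\<^sub>c\<close>. Finally \<open>A\<^sub>e\<close> is the up-set of \<open>I\<^sub>k\<close> for
  \<open>d\<^sub>k \<le> e < d\<^bsub>k+1\<^esub>\<close>, so only the \<open>c\<close> of the form \<open>d\<^sub>k\<close> with \<open>k \<ge> 1\<close> contribute.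
\<close>

section \<open>Exponent vectors and the divisibility order\<close>

abbreviation lookup where "lookup \<equiv> Poly_Mapping.lookup"
abbreviation update where "update \<equiv> Poly_Mapping.update"
abbreviation keys where "keys \<equiv> Poly_Mapping.keys"
abbreviation single where "single \<equiv> Poly_Mapping.single"

lemma exps_iff: "\<alpha> \<in> exps n \<longleftrightarrow> (\<forall>i. i \<notin> {1..n} \<longrightarrow> lookup \<alpha> i = 0)"
  unfolding exps_def subset_iff mem_Collect_eq in_keys_iff by auto

lemma single_in_exps: "i \<in> {1..n} \<Longrightarrow> single i b \<in> exps n"
  by (auto simp: exps_iff lookup_single when_def)

lemma lookup_update_if: "lookup (update k v f) i = (if i = k then v else lookup f i)"
  by (simp add: lookup_update)

lemma exps_update_last: "\<alpha> \<in> exps n \<Longrightarrow> update n 0 \<alpha> \<in> exps (n - 1)"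
  by (auto simp: exps_iff lookup_update_if)

lemma exps_update: "u \<in> exps (n - 1) \<Longrightarrow> n \<ge> 1 \<Longrightarrow> update n c u \<in> exps n"
  by (auto simp: exps_iff lookup_update_if)

text \<open>Divisibility is compared through \<open>lookup\<close>, because the order on finitely
  supported functions themselves is lexicographic. Subtraction is truncated at 0, so adding back is
  exact only under this comparison.\<close>

lemma le_fun_imp_ex_add:
  fixes \<gamma> \<alpha> :: expvec
  assumes "lookup \<gamma> \<le> lookup \<alpha>"
  shows "(\<alpha> - \<gamma>) + \<gamma> = \<alpha>"
  using assms by (intro poly_mapping_eqI) (simp add: lookup_add lookup_minus le_fun_def)

definition total :: "nat \<Rightarrow> expvec \<Rightarrow> nat" where
  "total n \<alpha> = (\<Sum>i\<in>{1..n}. lookup \<alpha> i)"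

lemma total_less:
  assumes "lookup \<gamma> \<le> lookup \<alpha>" "\<gamma> \<noteq> \<alpha>" "\<alpha> \<in> exps n"
  shows "total n \<gamma> < total n \<alpha>"
proof -
  obtain i where i: "lookup \<gamma> i \<noteq> lookup \<alpha> i" using assms(2) poly_mapping_eqI by metis
  have le: "lookup \<gamma> j \<le> lookup \<alpha> j" for j using assms(1) by (simp add: le_fun_def)
  have "lookup \<gamma> i < lookup \<alpha> i" using i le[of i] by simp
  moreover have "i \<in> {1..n}"
    using assms(3) calculation unfolding exps_iff by (metis not_less_zero)
  ultimately show ?thesis unfolding total_def using le by (intro sum_strict_mono_ex1) auto
qed

section \<open>Monomial ideals and up-sets\<close>

text \<open>Described by supports, so that an equality of ideals becomes an equality of exponent
  sets, see \<open>mon_span_eq_iff\<close>.\<close>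

definition mon_span :: "expvec set \<Rightarrow> ('k::field) mpol set" where
  "mon_span A = {p. keys p \<subseteq> A}"

lemma mon_in_mon_span [simp]: "(mon \<alpha> :: ('k::field) mpol) \<in> mon_span A \<longleftrightarrow> \<alpha> \<in> A"
  by (simp add: mon_span_def mon_def)

lemma mon_span_eq_iff [simp]: "(mon_span A :: ('k::field) mpol set) = mon_span B \<longleftrightarrow> A = B"
  by (metis mon_in_mon_span subset_antisym subsetI)

lemma carrier_pring: "carrier (pring n) = (mon_span (exps n) :: ('k::field) mpol set)"
  by (simp add: pring_def mon_span_def)

definition up_set :: "nat \<Rightarrow> expvec set \<Rightarrow> bool" where
  "up_set n A \<longleftrightarrow>
     A \<subseteq> exps n \<and> (\<forall>\<alpha>\<in>A. \<forall>\<beta>\<in>exps n. lookup \<alpha> \<le> lookup \<beta> \<longrightarrow> \<beta> \<in> A)"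

lemma up_setD: "up_set n A \<Longrightarrow> \<alpha> \<in> A \<Longrightarrow> \<beta> \<in> exps n \<Longrightarrow> lookup \<alpha> \<le> lookup \<beta> \<Longrightarrow> \<beta> \<in> A"
  by (auto simp: up_set_def)

definition up_closure :: "nat \<Rightarrow> expvec set \<Rightarrow> expvec set" where
  "up_closure n S = {\<alpha>\<in>exps n. \<exists>\<gamma>\<in>S. lookup \<gamma> \<le> lookup \<alpha>}"

lemma up_set_up_closure: "up_set n (up_closure n S)"
  by (auto simp: up_set_def up_closure_def intro: order_trans)

text \<open>The support of a product lies in the sumset of the two supports, and an up-set absorbs
  the addition of any exponent in \<open>exps n\<close>.\<close>

lemma ideal_mon_span:
  assumes "up_set n A"
  shows "ideal (mon_span A) (pring n :: ('k::field) mpol ring)"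
proof -
  interpret cring "pring n :: 'k mpol ring" by (rule cring_pring)
  have mult: "y * x \<in> mon_span A"
    if "x \<in> mon_span A" "y \<in> mon_span (exps n)" for x y :: "'k mpol"
  proof -
    have "a + b \<in> A" if "a \<in> exps n" "b \<in> A" for a b
      using that assms exps_add[of a n b] by (auto simp: up_set_def le_fun_def lookup_add)
    then show ?thesis using that keys_mult[of y x] unfolding mon_span_def by blast
  qed
  show ?thesis
  proof (rule idealI[OF ring_axioms])
    show "subgroup (mon_span A) (add_monoid (pring n :: 'k mpol ring))"
    proof (rule subgroup.intro)
      show "mon_span A \<subseteq> carrier (add_monoid (pring n :: 'k mpol ring))"
        using assms by (auto simp: pring_def mon_span_def up_set_def)
      fix x y :: "'k mpol" assume "x \<in> mon_span A" "y \<in> mon_span A"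
      then show "x \<otimes>\<^bsub>add_monoid (pring n)\<^esub> y \<in> mon_span A"
        using Poly_Mapping.keys_add[of x y] by (auto simp: pring_def mon_span_def)
    next
      show "\<one>\<^bsub>add_monoid (pring n)\<^esub> \<in> (mon_span A :: 'k mpol set)"
        by (simp add: pring_def mon_span_def)
      fix x :: "'k mpol" assume x: "x \<in> mon_span A"
      have xc: "x \<in> carrier (pring n)" and mc: "- x \<in> carrier (pring n)"
        using x assms by (auto simp: pring_def mon_span_def up_set_def)
      \<comment> \<open>The ring record only has an abstract additive inverse; it is identified with
        unary minus, which preserves supports.\<close>
      have "\<ominus>\<^bsub>pring n\<^esub> x = - x"
        by (rule minus_equality) (use xc mc in \<open>auto simp: pring_def\<close>)
      then show "inv\<^bsub>add_monoid (pring n)\<^esub> x \<in> mon_span A"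
        using x by (simp add: a_inv_def mon_span_def)
    qed
  next
    fix a x :: "'k mpol" assume "a \<in> mon_span A" "x \<in> carrier (pring n)"
    then show "x \<otimes>\<^bsub>pring n\<^esub> a \<in> mon_span A" "a \<otimes>\<^bsub>pring n\<^esub> x \<in> mon_span A"
      using mult[of a x] by (simp_all add: carrier_pring) (simp_all add: pring_def mult.commute)
  qed
qed

text \<open>One inclusion is the minimality of the generated ideal. For the other, each term of a
  polynomial in the span is a multiple of some generator, and the polynomial is the finite sum of
  its terms.\<close>

lemma Idl_mon:
  assumes S: "S \<subseteq> exps n"
  shows "Idl\<^bsub>pring n\<^esub> (mon ` S) = (mon_span (up_closure n S) :: ('k::field) mpol set)"
proof
  interpret cring "pring n :: 'k mpol ring" by (rule cring_pring)
  have sub: "(mon ` S :: 'k mpol set) \<subseteq> carrier (pring n)"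
    using S by (auto simp: carrier_pring)
  show "Idl\<^bsub>pring n\<^esub> (mon ` S) \<subseteq> (mon_span (up_closure n S) :: 'k mpol set)"
    by (rule genideal_minimal[OF ideal_mon_span[OF up_set_up_closure]])
      (use S in \<open>auto simp: up_closure_def\<close>)
  interpret J: ideal "Idl\<^bsub>pring n\<^esub> (mon ` S)" "pring n :: 'k mpol ring"
    by (rule genideal_ideal[OF sub])
  show "(mon_span (up_closure n S) :: 'k mpol set) \<subseteq> Idl\<^bsub>pring n\<^esub> (mon ` S)"
  proof
    fix p :: "'k mpol" assume p: "p \<in> mon_span (up_closure n S)"
    have term_in: "single \<alpha> c \<in> Idl\<^bsub>pring n\<^esub> (mon ` S)" if up: "\<alpha> \<in> up_closure n S" for \<alpha> and c :: 'k
    proof -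
      obtain \<gamma> where \<gamma>: "\<gamma> \<in> S" "lookup \<gamma> \<le> lookup \<alpha>" and \<alpha>: "\<alpha> \<in> exps n"
        using up by (auto simp: up_closure_def)
      have "(mon \<gamma> :: 'k mpol) \<in> Idl\<^bsub>pring n\<^esub> (mon ` S)" 
        by (rule subsetD[OF genideal_self[OF sub] imageI[OF \<gamma>(1)]])
      moreover have "single (\<alpha> - \<gamma>) c \<in> carrier (pring n)"
        using \<alpha> by (auto simp: pring_def exps_iff lookup_minus split: if_splits)
      ultimately have "single (\<alpha> - \<gamma>) c \<otimes>\<^bsub>pring n\<^esub> mon \<gamma> \<in> Idl\<^bsub>pring n\<^esub> (mon ` S)"
        by (rule J.I_l_closed)
      also have "single (\<alpha> - \<gamma>) c \<otimes>\<^bsub>pring n\<^esub> mon \<gamma> = single \<alpha> c"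
        using le_fun_imp_ex_add[OF \<gamma>(2)] by (simp add: pring_def mon_def mult_single)
      finally show ?thesis .
    qed
    have "(\<Sum>\<alpha>\<in>F. single \<alpha> (lookup p \<alpha>)) \<in> Idl\<^bsub>pring n\<^esub> (mon ` S)"
      if "finite F" "F \<subseteq> keys p" for F
      using that
    proof (induction F)
      case empty
      then show ?case using J.zero_closed by (simp add: pring_def)
    next
      case (insert x F)
      have "single x (lookup p x) \<in> Idl\<^bsub>pring n\<^esub> (mon ` S)"
        using insert p by (intro term_in) (auto simp: mon_span_def)
      then have "single x (lookup p x) \<oplus>\<^bsub>pring n\<^esub> (\<Sum>\<alpha>\<in>F. single \<alpha> (lookup p \<alpha>))
          \<in> Idl\<^bsub>pring n\<^esub> (mon ` S)"
        using insert by (intro J.a_closed) auto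
      then show ?case using insert by (simp add: pring_def)
    qed
    from this[OF finite_keys subset_refl]
    have "(\<Sum>\<alpha>\<in>keys p. single \<alpha> (lookup p \<alpha>)) \<in> Idl\<^bsub>pring n\<^esub> (mon ` S)" .
    moreover have "(\<Sum>\<alpha>\<in>keys p. single \<alpha> (lookup p \<alpha>)) = p"
      by (rule poly_mapping_eqI)
        (simp add: lookup_sum lookup_single when_def in_keys_iff)
    ultimately show "p \<in> Idl\<^bsub>pring n\<^esub> (mon ` S)" by simp
  qed
qed

lemma monomial_idealE:
  assumes "monomial_ideal n (I :: ('k::field) mpol set)"
  obtains A where "up_set n A" "I = mon_span A"
proof -
  obtain G where G: "G \<subseteq> mon ` exps n" "I = Idl\<^bsub>pring n\<^esub> G"
    using assms by (auto simp: monomial_ideal_def)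
  then obtain S where "S \<subseteq> exps n" "G = mon ` S" by (auto simp: subset_image_iff)
  with G show thesis using that[OF up_set_up_closure] by (simp add: Idl_mon)
qed

section \<open>Minimal generators\<close>

definition minimals :: "expvec set \<Rightarrow> expvec set" where
  "minimals A = {\<alpha>\<in>A. \<forall>\<gamma>\<in>A. lookup \<gamma> \<le> lookup \<alpha> \<longrightarrow> \<gamma> = \<alpha>}"

text \<open>Divisibility is well-founded on \<open>exps n\<close>: a proper divisor has a smaller
  \<open>total\<close>.\<close>

lemma minimal_below:
  assumes "A \<subseteq> exps n" "\<alpha> \<in> A"
  obtains \<mu> where "\<mu> \<in> minimals A" "lookup \<mu> \<le> lookup \<alpha>"
proof -
  have "\<exists>\<mu>\<in>minimals A. lookup \<mu> \<le> lookup \<alpha>"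
    using assms(2)
  proof (induction "total n \<alpha>" arbitrary: \<alpha> rule: less_induct)
    case less
    show ?case
    proof (cases "\<alpha> \<in> minimals A")
      case False
      then obtain \<gamma> where "\<gamma> \<in> A" "lookup \<gamma> \<le> lookup \<alpha>" "\<gamma> \<noteq> \<alpha>"
        using less.prems by (auto simp: minimals_def)
      with less.hyps[of \<gamma>] total_less[of \<gamma> \<alpha> n] less.prems assms(1) show ?thesis
        by (meson order_trans subsetD)
    qed auto
  qed
  with that show thesis by blast
qed

lemma up_closure_minimals:
  assumes "up_set n A"
  shows "up_closure n (minimals A) = A"
proof -
  have "\<exists>\<gamma>\<in>minimals A. lookup \<gamma> \<le> lookup \<alpha>" if "\<alpha> \<in> A" for \<alpha>
  proof -
    have "A \<subseteq> exps n" using assms by (simp add: up_set_def)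
    from minimal_below[OF this that] show ?thesis by blast
  qed
  then show ?thesis using assms by (auto simp: up_closure_def minimals_def up_set_def)
qed

text \<open>Whatever generates \<open>A\<close> has an element below each minimal
  \<open>\<mu>\<close>, and minimality forces that element to be \<open>\<mu>\<close>.\<close>

lemma minimals_subset_generators:
  assumes "up_closure n S = A" "S \<subseteq> exps n"
  shows "minimals A \<subseteq> S"
proof
  fix \<mu> assume \<mu>: "\<mu> \<in> minimals A"
  then obtain \<gamma> where \<gamma>: "\<gamma> \<in> S" "lookup \<gamma> \<le> lookup \<mu>"
    using assms(1) unfolding minimals_def up_closure_def by blast
  then have "\<gamma> \<in> A" using assms by (auto simp: up_closure_def)
  with \<gamma> \<mu> show "\<mu> \<in> S" by (auto simp: minimals_def)
qed

lemma min_gens_mon_span: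
  assumes A: "up_set n A"
  shows "min_gens n (mon_span A) = (mon ` minimals A :: ('k::field) mpol set)"
proof -
  have sub: "minimals A \<subseteq> exps n" using A by (auto simp: minimals_def up_set_def)
  have gen: "Idl\<^bsub>pring n\<^esub> (mon ` minimals A) = (mon_span A :: 'k mpol set)"
    using Idl_mon[OF sub] up_closure_minimals[OF A] by simp
  \<comment> \<open>Being least among all monomial generating sets gives irredundancy and uniqueness
    at once, which resolves the definite description in \<open>min_gens\<close>.\<close>
  have least: "mon ` minimals A \<subseteq> G"
    if G: "G \<subseteq> mon ` exps n" "Idl\<^bsub>pring n\<^esub> G = (mon_span A :: 'k mpol set)" for G :: "'k mpol set"
  proof -
    obtain S where S: "S \<subseteq> exps n" "G = mon ` S" using G(1) by (auto simp: subset_image_iff)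
    have "up_closure n S = A" using G(2) S Idl_mon[OF S(1), where 'k='k] by simp
    from minimals_subset_generators[OF this S(1)] S(2) show ?thesis by blast
  qed
  have "is_min_gens n (mon_span A) (mon ` minimals A :: 'k mpol set)"
    unfolding is_min_gens_def
  proof (intro conjI allI impI)
    show "mon ` minimals A \<subseteq> (mon ` exps n :: 'k mpol set)" using sub by blast
    fix H :: "'k mpol set" assume "H \<subset> mon ` minimals A"
    then show "Idl\<^bsub>pring n\<^esub> H \<noteq> mon_span A" using least[of H] sub by blast
  qed (rule gen)
  moreover have "G = mon ` minimals A" if "is_min_gens n (mon_span A) G" for G :: "'k mpol set"
    using that least[of G] gen unfolding is_min_gens_def by blast
  ultimately show ?thesis unfolding min_gens_def by (intro the_equality)
qed

section \<open>Irreducible components and corners\<close>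

definition ones :: "nat \<Rightarrow> expvec" where
  "ones n = (\<Sum>i\<in>{1..n}. single i 1)"

lemma lookup_ones: "lookup (ones n) i = (if i \<in> {1..n} then 1 else 0)"
  by (simp add: ones_def lookup_sum lookup_single when_def)

lemma minus_ones_in_exps: "\<beta> \<in> exps n \<Longrightarrow> \<beta> - ones n \<in> exps n"
  by (auto simp: exps_iff lookup_minus)

text \<open>This turns the complement of \<open>irr_comp n \<beta>\<close> into a box. Positivity of
  \<beta> matters: an entry 0 would stay 0 under truncated subtraction and admit exponents that must
  be excluded.\<close>

lemma minus_ones_le_iff:
  assumes "\<alpha> \<in> exps n" "\<beta> \<in> pos_exps n"
  shows "lookup \<alpha> \<le> lookup (\<beta> - ones n) \<longleftrightarrow> (\<forall>i\<in>{1..n}. lookup \<alpha> i < lookup \<beta> i)"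
proof -
  have *: "lookup \<alpha> i \<le> lookup (\<beta> - ones n) i \<longleftrightarrow> (i \<in> {1..n} \<longrightarrow> lookup \<alpha> i < lookup \<beta> i)" for i
  proof (cases "i \<in> {1..n}")
    case True
    then have "lookup \<beta> i > 0" using assms(2) by (auto simp: pos_exps_def)
    with True show ?thesis by (auto simp: lookup_minus lookup_ones)
  next
    case False
    with assms(1) show ?thesis by (auto simp: exps_iff)
  qed
  show ?thesis unfolding le_fun_def * by blast
qed

text \<open>Maximality of \<open>\<beta> - ones n\<close> outside \<open>A\<close> is tested only
  along unit vectors; for an up-set this suffices, by \<open>corner_maximal\<close>. The vectors
  \<open>\<beta> - ones n\<close> are the exponents of the socle monomials of the quotient by
  \<open>mon_span A\<close>.\<close>

definition corners :: "nat \<Rightarrow> expvec set \<Rightarrow> expvec set" where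
  "corners n A = {\<beta>\<in>pos_exps n. \<beta> - ones n \<notin> A \<and>
     (\<forall>i\<in>{1..n}. \<beta> - ones n + single i 1 \<in> A)}"

text \<open>A strictly larger \<open>\<gamma>\<close> would lie above some unit step from
  \<open>\<beta> - ones n\<close>; that step is in \<open>A\<close>, hence so would be
  \<open>\<gamma>\<close>.\<close>

lemma corner_maximal:
  assumes "up_set n A" "\<beta> \<in> corners n A" "\<gamma> \<in> exps n" "\<gamma> \<notin> A"
    and le: "lookup (\<beta> - ones n) \<le> lookup \<gamma>"
  shows "\<gamma> = \<beta> - ones n"
proof (rule ccontr)
  assume "\<gamma> \<noteq> \<beta> - ones n"
  then obtain i where "lookup (\<beta> - ones n) i \<noteq> lookup \<gamma> i" using poly_mapping_eqI by metis
  with le have i: "lookup (\<beta> - ones n) i < lookup \<gamma> i" by (metis le_funE le_neq_implies_less)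
  then have "i \<in> {1..n}" using assms(3) unfolding exps_iff by (metis not_less_zero)
  then have "\<beta> - ones n + single i 1 \<in> A" using assms(2) by (auto simp: corners_def)
  moreover have "lookup (\<beta> - ones n + single i 1) \<le> lookup \<gamma>"
    unfolding le_fun_def
  proof
    fix j show "lookup (\<beta> - ones n + single i 1) j \<le> lookup \<gamma> j"
      using i le_funD[OF le, of j] by (auto simp: lookup_add lookup_single when_def)
  qed
  ultimately show False using assms up_setD by blast
qed

text \<open>Exponent form of being Artinian. Finiteness of the complement yields maximal elements,
  and slices inherit it directly.\<close>

definition cofinite_up_set :: "nat \<Rightarrow> expvec set \<Rightarrow> bool" where
  "cofinite_up_set n A \<longleftrightarrow> up_set n A \<and> finite (exps n - A)"

text \<open>A vector outside \<open>A\<close> lies above no pure power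
  \<open>single i (b i)\<close>, so its entries are bounded; the sum of the \<open>b i\<close>
  serves as a common bound.\<close>

lemma cofinite_up_setI:
  assumes A: "up_set n A" and b: "\<forall>i\<in>{1..n}. \<exists>b. single i b \<in> A"
  shows "cofinite_up_set n A"
proof -
  obtain b where b: "\<And>i. i \<in> {1..n} \<Longrightarrow> single i (b i) \<in> A" using b by metis
  define N where "N = (\<Sum>i\<in>{1..n}. b i)"
  have "lookup \<alpha> i \<le> N" if \<alpha>: "\<alpha> \<in> exps n - A" and i: "i \<in> {1..n}" for \<alpha> i
  proof (rule ccontr)
    assume "\<not> lookup \<alpha> i \<le> N"
    moreover have "b i \<le> N" unfolding N_def using i by (intro member_le_sum) auto
    ultimately have "lookup (single i (b i)) \<le> lookup \<alpha>"
      by (auto simp: le_fun_def lookup_single when_def)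
    then show False using up_setD[OF A b[OF i]] \<alpha> by blast
  qed
  then have "lookup ` (exps n - A) \<subseteq>
      {f. \<forall>i. (i \<in> {1..n} \<longrightarrow> f i \<in> {..N}) \<and> (i \<notin> {1..n} \<longrightarrow> f i = 0)}"
    by (auto simp: exps_iff)
  then have "finite (lookup ` (exps n - A))"
    by (rule finite_subset) (intro finite_set_of_finite_funs; simp)
  then have "finite (exps n - A)"
    by (rule finite_imageD) (auto simp: inj_on_def intro: poly_mapping_eqI)
  with A show ?thesis by (simp add: cofinite_up_set_def)
qed

text \<open>The finite complement has a maximal element \<open>\<gamma>\<close> above
  \<open>\<alpha>\<close>; the corner is \<open>\<gamma> + ones n\<close>.\<close>

lemma corner_above:
  assumes A: "cofinite_up_set n A" and \<alpha>: "\<alpha> \<in> exps n - A"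
  obtains \<beta> where "\<beta> \<in> corners n A" "lookup \<alpha> \<le> lookup (\<beta> - ones n)"
proof -
  have "finite (lookup ` (exps n - A))" using A by (simp add: cofinite_up_set_def)
  from finite_has_maximal2[OF this imageI[OF \<alpha>]]
  obtain \<gamma> where \<gamma>: "\<gamma> \<in> exps n - A" "lookup \<alpha> \<le> lookup \<gamma>"
    and max: "\<And>\<delta>. \<delta> \<in> exps n - A \<Longrightarrow> lookup \<gamma> \<le> lookup \<delta> \<Longrightarrow> lookup \<gamma> = lookup \<delta>"
    by blast
  have eq: "\<gamma> + ones n - ones n = \<gamma>" by simp
  have "\<gamma> + single i 1 \<in> A" if "i \<in> {1..n}" for i
  proof (rule ccontr)
    assume "\<gamma> + single i 1 \<notin> A"
    moreover have "\<gamma> + single i 1 \<in> exps n" using \<gamma> that by (intro exps_add single_in_exps) auto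
    ultimately have "lookup \<gamma> = lookup (\<gamma> + single i 1)"
      by (intro max) (auto simp: le_fun_def lookup_add)
    then have "lookup \<gamma> i = lookup (\<gamma> + single i 1) i" by simp
    then show False by (simp add: lookup_add)
  qed
  moreover have "\<gamma> + ones n \<in> pos_exps n"
    using \<gamma> by (auto simp: pos_exps_def exps_iff lookup_add lookup_ones)
  ultimately have "\<gamma> + ones n \<in> corners n A" using \<gamma> by (simp add: corners_def eq)
  with \<gamma>(2) that[of "\<gamma> + ones n"] eq show thesis by simp
qed

lemma irr_comp_mon_span:
  assumes "\<beta> \<in> exps n"
  shows "irr_comp n \<beta> =
    (mon_span {\<alpha>\<in>exps n. \<exists>i\<in>{1..n}. lookup \<beta> i \<le> lookup \<alpha> i} :: ('k::field) mpol set)"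
proof -
  let ?S = "(\<lambda>i. single i (lookup \<beta> i)) ` {1..n}"
  have "?S \<subseteq> exps n" using single_in_exps by blast
  then have "irr_comp n \<beta> = (mon_span (up_closure n ?S) :: 'k mpol set)"
    unfolding irr_comp_def by (subst Idl_mon[symmetric]) (simp_all add: image_image)
  also have "up_closure n ?S = {\<alpha>\<in>exps n. \<exists>i\<in>{1..n}. lookup \<beta> i \<le> lookup \<alpha> i}"
    by (auto simp: up_closure_def le_fun_def lookup_single when_def)
  finally show ?thesis .
qed

text \<open>Intersecting components removes the union of their boxes; for empty \<open>B\<close>
  nothing is removed, in accordance with the unit ideal.\<close>

lemma comp_inter_mon_span:
  assumes "B \<subseteq> pos_exps n"
  shows "comp_inter n B =
    (mon_span {\<alpha>\<in>exps n. \<forall>\<beta>\<in>B. \<not> lookup \<alpha> \<le> lookup (\<beta> - ones n)} :: ('k::field) mpol set)"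
proof -
  have "irr_comp n \<beta> =
      (mon_span {\<alpha>\<in>exps n. \<not> lookup \<alpha> \<le> lookup (\<beta> - ones n)} :: 'k mpol set)" if "\<beta> \<in> B" for \<beta>
  proof -
    have \<beta>: "\<beta> \<in> pos_exps n" using that assms by blast
    then have "\<beta> \<in> exps n" by (simp add: pos_exps_def)
    from irr_comp_mon_span[OF this, where 'k='k] show ?thesis
      using minus_ones_le_iff[OF _ \<beta>] by (simp add: not_less cong: conj_cong)
  qed
  then show ?thesis unfolding comp_inter_def carrier_pring mon_span_def by fastforce
qed

text \<open>The boxes under the corners cover exactly the complement of \<open>A\<close>. Their tops
  are maximal outside \<open>A\<close>, so none lies in the box of another corner, and every
  decomposition must have each of them as the top of one of its own boxes.\<close>

lemma Irr_mon_span: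
  assumes A: "cofinite_up_set n A"
  shows "Irr n (mon_span A :: ('k::field) mpol set) = corners n A"
proof -
  have up: "up_set n A" and Asub: "A \<subseteq> exps n"
    using A by (auto simp: cofinite_up_set_def up_set_def)
  have pos: "corners n A \<subseteq> pos_exps n" by (auto simp: corners_def)
  have corner_exps: "\<beta> - ones n \<in> exps n - A" if "\<beta> \<in> corners n A" for \<beta>
    using that by (auto simp: corners_def pos_exps_def intro: minus_ones_in_exps)
  \<comment> \<open>On positive vectors the truncated subtraction of \<open>ones n\<close> loses
    nothing, so a component is determined by the top of its box.\<close>
  have inj: "inj_on (\<lambda>\<beta>. \<beta> - ones n) (pos_exps n)"
  proof (rule inj_on_inverseI)
    fix \<beta> assume \<beta>: "\<beta> \<in> pos_exps n"
    then have "lookup (ones n) i \<le> lookup \<beta> i" for i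
      by (auto simp: lookup_ones pos_exps_def Suc_le_eq)
    then show "\<beta> - ones n + ones n = \<beta>" by (intro le_fun_imp_ex_add) (simp add: le_fun_def)
  qed
  have "{\<alpha>\<in>exps n. \<forall>\<beta>\<in>corners n A. \<not> lookup \<alpha> \<le> lookup (\<beta> - ones n)} = A" (is "?L = A")
  proof
    show "?L \<subseteq> A" using corner_above[OF A] by blast
    show "A \<subseteq> ?L" using Asub corner_exps up_setD[OF up] by blast
  qed
  then have inter: "comp_inter n (corners n A) = (mon_span A :: 'k mpol set)"
    by (simp add: comp_inter_mon_span[OF pos])
  have dec: "is_irr_decomp n (mon_span A :: 'k mpol set) (corners n A)"
    unfolding is_irr_decomp_def
  proof (intro conjI ballI)
    show "finite (corners n A)"
    proof (rule finite_imageD)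
      show "finite ((\<lambda>\<beta>. \<beta> - ones n) ` corners n A)"
        by (rule finite_subset[of _ "exps n - A"])
          (use corner_exps A in \<open>auto simp: cofinite_up_set_def\<close>)
      show "inj_on (\<lambda>\<beta>. \<beta> - ones n) (corners n A)" using inj pos by (rule inj_on_subset)
    qed
    fix \<beta> assume \<beta>: "\<beta> \<in> corners n A"
    have "\<not> lookup (\<beta> - ones n) \<le> lookup (\<beta>' - ones n)" if \<beta>': "\<beta>' \<in> corners n A - {\<beta>}" for \<beta>'
      using corner_maximal[OF up \<beta>, of "\<beta>' - ones n"] corner_exps[of \<beta>'] \<beta>' \<beta>
        subsetD[OF pos, of \<beta>] subsetD[OF pos, of \<beta>'] inj_onD[OF inj, of \<beta> \<beta>'] by auto
    then have "(mon (\<beta> - ones n) :: 'k mpol) \<in> comp_inter n (corners n A - {\<beta>})"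
      using corner_exps[OF \<beta>] by (subst comp_inter_mon_span) (use pos in auto)
    moreover have "(mon (\<beta> - ones n) :: 'k mpol) \<notin> mon_span A" using corner_exps[OF \<beta>] by simp
    ultimately show "comp_inter n (corners n A - {\<beta>}) \<noteq> (mon_span A :: 'k mpol set)" by blast
  qed (use pos inter in auto)
  have "B = corners n A" if "is_irr_decomp n (mon_span A :: 'k mpol set) B" for B
  proof -
    have B: "B \<subseteq> pos_exps n" and BI: "comp_inter n B = (mon_span A :: 'k mpol set)"
      and irred: "\<And>\<beta>. \<beta> \<in> B \<Longrightarrow> comp_inter n (B - {\<beta>}) \<noteq> (mon_span A :: 'k mpol set)"
      using that by (auto simp: is_irr_decomp_def)
    have Aeq: "A = {\<alpha>\<in>exps n. \<forall>\<beta>\<in>B. \<not> lookup \<alpha> \<le> lookup (\<beta> - ones n)}"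
      using BI comp_inter_mon_span[OF B, where 'k='k] by simp
    have "\<beta> \<in> B" if \<beta>: "\<beta> \<in> corners n A" for \<beta>
    proof -
      obtain b where b: "b \<in> B" "lookup (\<beta> - ones n) \<le> lookup (b - ones n)"
        using corner_exps[OF \<beta>] Aeq by blast
      have "b - ones n \<in> exps n" using b B by (auto simp: pos_exps_def intro: minus_ones_in_exps)
      moreover have "b - ones n \<notin> A" using b(1) Aeq by blast
      ultimately have "b - ones n = \<beta> - ones n" using corner_maximal[OF up \<beta>] b(2) by blast
      then show ?thesis using inj_onD[OF inj, of b \<beta>] b(1) B \<beta> pos by auto
    qed
    then have sub: "corners n A \<subseteq> B" by blast
    \<comment> \<open>Surplus components are redundant: without \<open>b\<close> all corners are
      still present and already cut out \<open>mon_span A\<close>.\<close>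
    have "b \<in> corners n A" if "b \<in> B" for b
    proof (rule ccontr)
      assume "b \<notin> corners n A"
      then have "comp_inter n (B - {b}) \<subseteq> (comp_inter n (corners n A) :: 'k mpol set)"
        using sub by (auto simp: comp_inter_def)
      moreover have "comp_inter n B \<subseteq> (comp_inter n (B - {b}) :: 'k mpol set)"
        by (auto simp: comp_inter_def)
      ultimately show False using irred[OF that] BI inter by auto
    qed
    with sub show ?thesis by blast
  qed
  with dec show ?thesis unfolding Irr_def by (intro the_equality)
qed

section \<open>Slices in the last variable\<close>

definition slice :: "nat \<Rightarrow> expvec set \<Rightarrow> nat \<Rightarrow> expvec set" where
  "slice n A e = {u\<in>exps (n - 1). update n e u \<in> A}"

lemma le_update_iff:
  assumes "u \<in> exps (n - 1)" "n \<ge> 1"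
  shows "lookup \<mu> \<le> lookup (update n e u) \<longleftrightarrow>
    lookup \<mu> n \<le> e \<and> lookup (update n 0 \<mu>) \<le> lookup u"
  using assms by (auto simp: le_fun_def lookup_update_if exps_iff)

text \<open>Lying above a minimal \<open>\<mu>\<close> splits into a bound on the last entry of
  \<open>\<mu>\<close> and a comparison of the remaining entries with \<open>u\<close>.\<close>

lemma slice_eq_up_closure:
  assumes A: "up_set n A" and n: "n \<ge> 1"
  shows "slice n A e = up_closure (n - 1) (update n 0 ` {\<mu>\<in>minimals A. lookup \<mu> n \<le> e})"
proof -
  have "update n e u \<in> A \<longleftrightarrow> (\<exists>\<mu>\<in>minimals A. lookup \<mu> \<le> lookup (update n e u))"
    if "u \<in> exps (n - 1)" for u
    using exps_update[OF that n] by (subst up_closure_minimals[OF A, symmetric]) (simp add: up_closure_def)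
  then show ?thesis unfolding slice_def up_closure_def using le_update_iff[OF _ n] by auto
qed

text \<open>The truncated exponents that generate the coefficient ideal are those that generate the
  slice, so the ideals of the theorem become slices.\<close>

lemma coeff_ideal_mon_span:
  assumes A: "up_set n A" and n: "n \<ge> 1"
  shows "coeff_ideal n (mon_span A) e = (mon_span (slice n A e) :: ('k::field) mpol set)"
proof -
  let ?M = "{\<mu>\<in>minimals A. lookup \<mu> n \<le> e}"
  have "{m \<in> mon ` minimals A :: 'k mpol set. mon_deg n m \<le> e} = mon ` ?M"
    by (auto simp: mon_deg_def mon_exp_mon)
  then have "mon_coeff n ` {m \<in> min_gens n (mon_span A) :: 'k mpol set. mon_deg n m \<le> e}
      = mon ` update n 0 ` ?M"
    by (simp add: min_gens_mon_span[OF A] image_image mon_coeff_def mon_exp_mon)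
  moreover have "update n 0 ` ?M \<subseteq> exps (n - 1)"
    using A exps_update_last by (auto simp: minimals_def up_set_def)
  ultimately show ?thesis
    unfolding coeff_ideal_def by (simp add: Idl_mon slice_eq_up_closure[OF A n])
qed

lemma slice_mono:
  assumes "up_set n A" "n \<ge> 1" "e \<le> e'"
  shows "slice n A e \<subseteq> slice n A e'"
proof -
  have "{\<mu>\<in>minimals A. lookup \<mu> n \<le> e} \<subseteq> {\<mu>\<in>minimals A. lookup \<mu> n \<le> e'}"
    using assms(3) by auto
  then show ?thesis unfolding slice_eq_up_closure[OF assms(1,2)] up_closure_def by blast
qed

text \<open>The height enters a slice only through the minimal generators whose last entry it
  bounds, so slices are constant between consecutive generator degrees.\<close>

lemma slice_cong:
  assumes "up_set n A" "n \<ge> 1"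
    and "\<And>\<mu>. \<mu> \<in> minimals A \<Longrightarrow> lookup \<mu> n \<le> e \<longleftrightarrow> lookup \<mu> n \<le> e'"
  shows "slice n A e = slice n A e'"
proof -
  have "{\<mu>\<in>minimals A. lookup \<mu> n \<le> e} = {\<mu>\<in>minimals A. lookup \<mu> n \<le> e'}"
    using assms(3) by blast
  then show ?thesis by (simp add: slice_eq_up_closure[OF assms(1,2)])
qed

lemma up_set_slice:
  assumes "up_set n A" "n \<ge> 1"
  shows "up_set (n - 1) (slice n A e)"
  by (simp add: slice_eq_up_closure[OF assms] up_set_up_closure)

text \<open>Putting \<open>e\<close> in position \<open>n\<close> embeds the complement of the slice
  into that of \<open>A\<close>.\<close>

lemma cofinite_slice:
  assumes A: "cofinite_up_set n A" and n: "n \<ge> 1"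
  shows "cofinite_up_set (n - 1) (slice n A e)"
proof -
  have up: "up_set n A" and fin: "finite (exps n - A)"
    using A by (auto simp: cofinite_up_set_def)
  have "inj_on (update n e) (exps (n - 1))"
  proof (rule inj_on_inverseI)
    fix u assume "u \<in> exps (n - 1)"
    then have "lookup u n = 0" using n by (auto simp: exps_iff)
    then show "update n 0 (update n e u) = u"
      by (intro poly_mapping_eqI) (simp add: lookup_update_if)
  qed
  then have "inj_on (update n e) (exps (n - 1) - slice n A e)" by (rule inj_on_subset) blast
  moreover have "update n e ` (exps (n - 1) - slice n A e) \<subseteq> exps n - A"
    using exps_update[OF _ n] by (auto simp: slice_def)
  ultimately have "finite (exps (n - 1) - slice n A e)" using fin by (rule inj_on_finite)
  with up_set_slice[OF up n] show ?thesis by (simp add: cofinite_up_set_def)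
qed

text \<open>The unit-step condition passes from \<open>S\<close> to the larger \<open>T\<close>, so
  a corner of \<open>S\<close> fails to be one of \<open>T\<close> exactly when
  \<open>u - ones n\<close> enters \<open>T\<close>.\<close>

lemma corners_diff:
  assumes "S \<subseteq> T"
  shows "corners n S - corners n T = {u\<in>corners n S. u - ones n \<in> T}"
  using assms by (auto simp: corners_def)

text \<open>Of the unit steps, the first \<open>n - 1\<close> stay at height \<open>c - 1\<close>
  and test for a corner of that slice, while the last one rises to height \<open>c\<close> and tests
  membership in the next slice. Heights at which the slice does not change contribute
  nothing.\<close>

lemma corners_slice:
  assumes A: "up_set n A" and n: "n \<ge> 1"
  shows "corners n A = (\<Union>c\<in>{1..}. append_coord n
    (corners (n - 1) (slice n A (c - 1)) - corners (n - 1) (slice n A c)) c)"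
proof -
  have diff: "corners (n - 1) (slice n A (c - 1)) - corners (n - 1) (slice n A c)
      = {u\<in>corners (n - 1) (slice n A (c - 1)). u - ones (n - 1) \<in> slice n A c}" for c
    by (rule corners_diff) (simp add: slice_mono[OF A n])
  have key: "update n c u \<in> corners n A \<longleftrightarrow>
      u \<in> corners (n - 1) (slice n A (c - 1)) \<and> u - ones (n - 1) \<in> slice n A c"
    if c: "c \<ge> 1" and u: "u \<in> pos_exps (n - 1)" for u c
  proof -
    have ue: "u \<in> exps (n - 1)" using u by (simp add: pos_exps_def)
    have pos: "update n c u \<in> pos_exps n"
      using u c exps_update[OF ue n] by (auto simp: pos_exps_def lookup_update_if)
    \<comment> \<open>Subtracting \<open>ones n\<close> lowers the height to \<open>c - 1\<close>;
      the step back up to \<open>c\<close> in \<open>e2\<close> relies on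
      \<open>c \<ge> 1\<close>.\<close>
    have e1: "update n c u - ones n = update n (c - 1) (u - ones (n - 1))"
      using n by (intro poly_mapping_eqI) (auto simp: lookup_update_if lookup_minus lookup_ones)
    have e2: "update n (c - 1) (u - ones (n - 1)) + single n 1 = update n c (u - ones (n - 1))"
      using n c by (intro poly_mapping_eqI)
        (auto simp: lookup_update_if lookup_add lookup_single when_def)
    have e3: "update n (c - 1) (u - ones (n - 1)) + single i 1
        = update n (c - 1) (u - ones (n - 1) + single i 1)" if "i \<in> {1..n - 1}" for i
      using that n by (intro poly_mapping_eqI)
        (auto simp: lookup_update_if lookup_add lookup_single when_def)
    have v: "u - ones (n - 1) \<in> exps (n - 1)" using ue by (rule minus_ones_in_exps)
    have w: "u - ones (n - 1) + single i 1 \<in> exps (n - 1)" if "i \<in> {1..n - 1}" for i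
      using v that by (intro exps_add single_in_exps)
    have "{1..n} = insert n {1..n - 1}" using n by auto
    then show ?thesis
      using u pos v w by (auto simp: corners_def slice_def e1 e2 e3 simp del: One_nat_def)
  qed
  show ?thesis
  proof (intro equalityI subsetI)
    fix \<beta> assume \<beta>: "\<beta> \<in> corners n A"
    then have pos: "\<beta> \<in> pos_exps n" by (simp add: corners_def)
    define u where "u = update n 0 \<beta>"
    have eq: "\<beta> = update n (lookup \<beta> n) u"
      by (intro poly_mapping_eqI) (simp add: u_def lookup_update_if)
    have "u \<in> pos_exps (n - 1)"
      using pos exps_update_last[of \<beta> n] by (auto simp: u_def pos_exps_def lookup_update_if)
    moreover have c: "lookup \<beta> n \<ge> 1" using pos n by (auto simp: pos_exps_def Suc_le_eq)
    ultimately show "\<beta> \<in> (\<Union>c\<in>{1..}. append_coord n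
        (corners (n - 1) (slice n A (c - 1)) - corners (n - 1) (slice n A c)) c)"
      using key[of "lookup \<beta> n" u] \<beta> eq unfolding diff append_coord_def by auto
  next
    fix \<beta> assume "\<beta> \<in> (\<Union>c\<in>{1..}. append_coord n
        (corners (n - 1) (slice n A (c - 1)) - corners (n - 1) (slice n A c)) c)"
    then obtain c u where cu: "c \<ge> 1" "u \<in> corners (n - 1) (slice n A (c - 1))"
        "u - ones (n - 1) \<in> slice n A c" "\<beta> = update n c u"
      unfolding diff append_coord_def by auto
    moreover have "u \<in> pos_exps (n - 1)" using cu(2) by (simp add: corners_def)
    ultimately show "\<beta> \<in> corners n A" using key[of c u] by blast
  qed
qed

text \<open>The last entry of a vector recovers \<open>d k\<close>, and injectivity then recovers
  \<open>k\<close>, whatever the sets \<open>U k\<close> are.\<close>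

lemma disjoint_append_coord:
  assumes "inj_on d K"
  shows "disjoint_family_on (\<lambda>k. append_coord n (U k) (d k)) K"
  unfolding disjoint_family_on_def
proof (intro ballI impI)
  fix j k assume jk: "j \<in> K" "k \<in> K" "j \<noteq> k"
  then have ne: "d j \<noteq> d k" using assms by (auto simp: inj_on_def)
  have last: "lookup \<beta> n = c" if "\<beta> \<in> append_coord n V c" for \<beta> V c
    using that by (auto simp: append_coord_def lookup_update_if)
  show "append_coord n (U j) (d j) \<inter> append_coord n (U k) (d k) = {}"
    using ne last by (metis disjoint_iff)
qed

section \<open>From all heights to the generator degrees\<close>

theorem theorem4:
  fixes n s :: nat
    and d :: "nat \<Rightarrow> nat"
    and I :: "('k::field) mpol set"
    and J :: "nat \<Rightarrow> 'k mpol set"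
  assumes "n \<ge> 2"
    and "artinian_monomial_ideal n I"
    and "d 0 = 0"
    and "strict_mono_on {0..s} d"
    and "d ` {0..s} = mon_deg n ` min_gens n I"
    and "\<And>k. k \<le> s \<Longrightarrow> J k = coeff_ideal n I (d k)"
  shows "Irr n I = (\<Union>k\<in>{1..s}. append_coord n (Irr (n - 1) (J (k - 1)) - Irr (n - 1) (J k)) (d k))
     \<and> disjoint_family_on
         (\<lambda>k. append_coord n (Irr (n - 1) (J (k - 1)) - Irr (n - 1) (J k)) (d k)) {1..s}"
proof -
  have n: "n \<ge> 1" using assms(1) by simp
  obtain A where up: "up_set n A" and I: "I = mon_span A"
    using assms(2) monomial_idealE unfolding artinian_monomial_ideal_def by blast
  have cof: "cofinite_up_set n A"
    using assms(2) up by (intro cofinite_up_setI) (auto simp: artinian_monomial_ideal_def I)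
  have degs: "d ` {0..s} = (\<lambda>\<mu>. lookup \<mu> n) ` minimals A"
    using assms(5) by (simp add: I min_gens_mon_span[OF up] image_image mon_deg_def mon_exp_mon)
  define D where "D c = corners (n - 1) (slice n A (c - 1)) - corners (n - 1) (slice n A c)" for c
  have Irr_J: "Irr (n - 1) (J k) = corners (n - 1) (slice n A (d k))" if "k \<le> s" for k
    using assms(6)[OF that] Irr_mon_span[OF cofinite_slice[OF cof n], where 'k='k]
    by (simp add: I coeff_ideal_mon_span[OF up n])
  have less: "d i < d j \<longleftrightarrow> i < j" if "i \<le> s" "j \<le> s" for i j
    using strict_mono_on_less[OF assms(4), of i j] that by simp
  have D_eq: "Irr (n - 1) (J (k - 1)) - Irr (n - 1) (J k) = D (d k)" if k: "k \<in> {1..s}" for k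
  proof -
    \<comment> \<open>No generator degree lies strictly between \<open>d (k - 1)\<close> and
      \<open>d k\<close>.\<close>
    have "slice n A (d k - 1) = slice n A (d (k - 1))"
    proof (rule slice_cong[OF up n])
      fix \<mu> assume "\<mu> \<in> minimals A"
      then obtain j where j: "j \<le> s" "lookup \<mu> n = d j" using degs by fastforce
      \<comment> \<open>Since \<open>d k > d 0\<close>, the degree \<open>d k\<close> is positive
        and \<open>d k - 1\<close> is not truncated.\<close>
      have "d j \<le> d k - 1 \<longleftrightarrow> d j < d k" using less[of 0 k] k by auto
      also have "\<dots> \<longleftrightarrow> j < k" using less[of j k] j k by simp
      also have "\<dots> \<longleftrightarrow> \<not> k - 1 < j" using k by auto
      also have "\<dots> \<longleftrightarrow> \<not> d (k - 1) < d j" using less[of "k - 1" j] j k by auto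
      finally show "lookup \<mu> n \<le> d k - 1 \<longleftrightarrow> lookup \<mu> n \<le> d (k - 1)" using j by auto
    qed
    moreover have "k - 1 \<le> s" "k \<le> s" using k by auto
    ultimately show ?thesis by (simp only: D_def Irr_J)
  qed
  define K where "K = d ` {1..s}"
  \<comment> \<open>As \<open>c \<ge> 1\<close> also excludes \<open>d 0 = 0\<close>, such a height
    is no generator degree at all, and the slice does not change from \<open>c - 1\<close> to
    \<open>c\<close>.\<close>
  have D_empty: "D c = {}" if c: "c \<ge> 1" "c \<notin> d ` {1..s}" for c
  proof -
    have "c \<notin> d ` {0..s}"
    proof
      assume "c \<in> d ` {0..s}"
      then obtain k where k: "k \<le> s" "c = d k" by auto
      with c assms(3) have "k \<noteq> 0" by (metis not_one_le_zero)
      with k c(2) show False by auto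
    qed
    then have ne: "lookup \<mu> n \<noteq> c" if "\<mu> \<in> minimals A" for \<mu> using that degs by blast
    have "slice n A (c - 1) = slice n A c"
    proof (rule slice_cong[OF up n])
      fix \<mu> assume "\<mu> \<in> minimals A"
      from ne[OF this] c(1) show "lookup \<mu> n \<le> c - 1 \<longleftrightarrow> lookup \<mu> n \<le> c" by linarith
    qed
    then show ?thesis by (simp add: D_def)
  qed
  have "Irr n I = (\<Union>c\<in>{1..}. append_coord n (D c) c)"
    unfolding D_def I Irr_mon_span[OF cof] by (rule corners_slice[OF up n])
  also have "\<dots> = (\<Union>c\<in>K. append_coord n (D c) c)"
  proof -
    have "1 \<le> d k" if "k \<in> {1..s}" for k using less[of 0 k] that by auto
    then have "K \<subseteq> {1..}" by (auto simp: K_def)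
    moreover have "append_coord n (D c) c = {}" if "c \<in> {1..} - K" for c
      using that D_empty[of c] by (simp add: append_coord_def K_def)
    ultimately show ?thesis by blast
  qed
  also have "\<dots> = (\<Union>k\<in>{1..s}. append_coord n (Irr (n - 1) (J (k - 1)) - Irr (n - 1) (J k)) (d k))"
    using D_eq by (simp add: K_def)
  finally have "Irr n I = \<dots>" .
  moreover have "inj_on d {1..s}"
    using strict_mono_on_imp_inj_on[OF assms(4)] by (rule inj_on_subset) auto
  ultimately show ?thesis by (intro conjI disjoint_append_coord)
qed

end
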